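(* Let $\mathscr H$ be a separable Hilbert space, $\Gamma:\mathrm{dom}(\Gamma)\subset\mathscr H\to\mathscr H$ a closed, densely-defined, nilpotent operator, and $B:\mathscr H\to\mathscr H$ a bounded, positive-definite, self-adjoint isomorphism. Let $\Pi:=\Gamma+\Gamma^*$ and $\Pi_B:=\Gamma+\Gamma^{*,B}$. Then $\ker(\Pi_B)\cong\ker(\Pi)$. An isomorphism is given by $$\Phi:=P_1|_{\ker(\Pi)}:\ker(\Pi)\to\ker(\Pi_B),$$ where $P_1$ is the projection onto $\ker(\Pi_B)$ along $\overline{\mathrm{ran}(\Pi)}$ (for the splitting $\mathscr H=\ker(\Pi_B)\oplus\overline{\mathrm{ran}(\Pi)}$). Its inverse is $$\Phi^{-1}=P_2|_{\ker(\Pi_B)}:\ker(\Pi_B)\to\ker(\Pi),$$ where $P_2$ is the projection onto $\ker(\Pi)$ along $\overline{\mathrm{ran}(\Pi)}$.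
   Context: Nilpotent means $\mathrm{ran}(\Gamma)\subset\ker(\Gamma)$. $\Gamma^*$ is the adjoint of $\Gamma$ with respect to $\langle\cdot,\cdot\rangle$; $\Gamma^{*,B}$ is the adjoint of $\Gamma$ with respect to the inner product $\langle u,v\rangle_B:=\langle Bu,v\rangle$. The sums have domains $\mathrm{dom}(\Pi)=\mathrm{dom}(\Gamma)\cap\mathrm{dom}(\Gamma^* )$ and $\mathrm{dom}(\Pi_B)=\mathrm{dom}(\Gamma)\cap\mathrm{dom}(\Gamma^{*,B})$. *)

theory Defs
  imports "HOL-Analysis.Analysis"
begin

section \<open>Hilbert spaces over the real or complex numbers\<close>

text \<open>
  HOL-Analysis only has real inner products. The following class allows both scalar fields to be
  treated at once: by the Gelfand--Mazur theorem its only instances, up to isomorphism, are the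
  reals with trivial conjugation and the complex numbers with the usual one.
\<close>

class hilbert_scalar = real_normed_field +
  fixes scalar_cnj :: "'a \<Rightarrow> 'a"
  assumes scalar_cnj_add: "scalar_cnj (a + b) = scalar_cnj a + scalar_cnj b"
    and scalar_cnj_mult: "scalar_cnj (a * b) = scalar_cnj a * scalar_cnj b"
    and mult_scalar_cnj: "a * scalar_cnj a = (norm a)\<^sup>2 *\<^sub>R 1"

instantiation real :: hilbert_scalar
begin

definition scalar_cnj_real :: "real \<Rightarrow> real" where "scalar_cnj_real a = a"

instance
  by standard (simp_all add: scalar_cnj_real_def power2_eq_square)

end

instantiation complex :: hilbert_scalar
begin

definition scalar_cnj_complex :: "complex \<Rightarrow> complex" where "scalar_cnj_complex = cnj"

instance
  by standard (simp_all add: scalar_cnj_complex_def complex_norm_square[symmetric] scaleR_conv_of_real)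

end

text \<open>
  The inner product is linear in its first argument. Completeness comes from the sort of the
  carrier type, whose norm is required to be the one induced by the inner product.
\<close>

locale hilbert_space = vector_space scl
  for scl :: "'k::hilbert_scalar \<Rightarrow> 'h::banach \<Rightarrow> 'h" +
  fixes ip :: "'h \<Rightarrow> 'h \<Rightarrow> 'k"
  assumes scale_of_real: "scl (of_real r) x = r *\<^sub>R x"
    and ip_add_left: "ip (x + y) z = ip x z + ip y z"
    and ip_scale_left: "ip (scl a x) y = a * ip x y"
    and ip_commute: "ip x y = scalar_cnj (ip y x)"
    and ip_self: "ip x x = of_real ((norm x)\<^sup>2)"

lemma hilbert_space_real:
  "hilbert_space (scaleR :: real \<Rightarrow> 'h \<Rightarrow> 'h::{real_inner, banach}) inner"
  by unfold_locales
    (simp_all add: algebra_simps inner_commute scalar_cnj_real_def power2_norm_eq_inner)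

lemma hilbert_space_complex:
  "hilbert_space ((*) :: complex \<Rightarrow> complex \<Rightarrow> complex) (\<lambda>x y. x * cnj y)"
  by unfold_locales
    (simp_all add: algebra_simps scaleR_conv_of_real scalar_cnj_complex_def complex_norm_square[symmetric])


section \<open>Subspaces, isomorphisms and projections\<close>

definition linear_on :: "('k::field \<Rightarrow> 'h::ab_group_add \<Rightarrow> 'h) \<Rightarrow> 'h set \<Rightarrow> ('h \<Rightarrow> 'h) \<Rightarrow> bool" where
  "linear_on scl M f \<longleftrightarrow>
     module.subspace scl M \<and>
     (\<forall>x\<in>M. \<forall>y\<in>M. f (x + y) = f x + f y) \<and>
     (\<forall>a. \<forall>x\<in>M. f (scl a x) = scl a (f x))"

definition isomorphism_on ::
  "('k::field \<Rightarrow> 'h::real_normed_vector \<Rightarrow> 'h) \<Rightarrow> 'h set \<Rightarrow> 'h set \<Rightarrow> ('h \<Rightarrow> 'h) \<Rightarrow> bool" where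
  "isomorphism_on scl M N f \<longleftrightarrow>
     linear_on scl M f \<and> module.subspace scl N \<and> bij_betw f M N \<and>
     homeomorphism M N f (inv_into M f)"

definition isomorphic_subspaces ::
  "('k::field \<Rightarrow> 'h::real_normed_vector \<Rightarrow> 'h) \<Rightarrow> 'h set \<Rightarrow> 'h set \<Rightarrow> bool" where
  "isomorphic_subspaces scl M N \<longleftrightarrow> (\<exists>f. isomorphism_on scl M N f)"

definition direct_sum ::
  "('k::field \<Rightarrow> 'h::real_normed_vector \<Rightarrow> 'h) \<Rightarrow> 'h set \<Rightarrow> 'h set \<Rightarrow> bool" where
  "direct_sum scl M N \<longleftrightarrow>
     module.subspace scl M \<and> module.subspace scl N \<and> closed M \<and> closed N \<and>
     M \<inter> N = {0} \<and> (\<forall>x. \<exists>m\<in>M. \<exists>n\<in>N. x = m + n)"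

text \<open>The projection onto \<open>M\<close> along \<open>N\<close>; meaningful when the space is the direct sum of the two.\<close>

definition proj_along :: "'h::ab_group_add set \<Rightarrow> 'h set \<Rightarrow> 'h \<Rightarrow> 'h" where
  "proj_along M N x = (THE m. m \<in> M \<and> x - m \<in> N)"


section \<open>Unbounded operators\<close>

text \<open>
  An operator is a domain together with a function; the values of the function outside the domain
  carry no meaning.
\<close>

type_synonym 'h unbounded_op = "'h set \<times> ('h \<Rightarrow> 'h)"

definition op_dom :: "'h unbounded_op \<Rightarrow> 'h set" where
  "op_dom T = fst T"

definition op_app :: "'h unbounded_op \<Rightarrow> 'h \<Rightarrow> 'h" where
  "op_app T = snd T"

definition op_ker :: "'h::zero unbounded_op \<Rightarrow> 'h set" where
  "op_ker T = {u \<in> op_dom T. op_app T u = 0}"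

definition op_ran :: "'h unbounded_op \<Rightarrow> 'h set" where
  "op_ran T = op_app T ` op_dom T"

definition linear_op ::
  "('k::field \<Rightarrow> 'h::ab_group_add \<Rightarrow> 'h) \<Rightarrow> 'h unbounded_op \<Rightarrow> bool" where
  "linear_op scl T \<longleftrightarrow> linear_on scl (op_dom T) (op_app T)"

definition closed_op :: "'h::topological_space unbounded_op \<Rightarrow> bool" where
  "closed_op T \<longleftrightarrow> closed {(u, op_app T u) | u. u \<in> op_dom T}"

definition densely_defined :: "'h::topological_space unbounded_op \<Rightarrow> bool" where
  "densely_defined T \<longleftrightarrow> closure (op_dom T) = UNIV"

definition nilpotent_op :: "'h::zero unbounded_op \<Rightarrow> bool" where
  "nilpotent_op T \<longleftrightarrow> op_ran T \<subseteq> op_ker T"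

definition op_sum :: "'h::plus unbounded_op \<Rightarrow> 'h unbounded_op \<Rightarrow> 'h unbounded_op" where
  "op_sum S T = (op_dom S \<inter> op_dom T, \<lambda>u. op_app S u + op_app T u)"

text \<open>
  The adjoint with respect to the inner product \<open>ip\<close>. The described value is unique as soon as
  \<open>T\<close> is densely defined and \<open>ip\<close> induces the topology of the space.
\<close>

definition op_adjoint :: "('h \<Rightarrow> 'h \<Rightarrow> 'k) \<Rightarrow> 'h unbounded_op \<Rightarrow> 'h unbounded_op" where
  "op_adjoint ip T =
     ({v. \<exists>w. \<forall>u\<in>op_dom T. ip (op_app T u) v = ip u w},
      \<lambda>v. THE w. \<forall>u\<in>op_dom T. ip (op_app T u) v = ip u w)"


section \<open>Weighted inner products\<close>

definition self_adjoint_map :: "('h \<Rightarrow> 'h \<Rightarrow> 'k) \<Rightarrow> ('h \<Rightarrow> 'h) \<Rightarrow> bool" where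
  "self_adjoint_map ip B \<longleftrightarrow> (\<forall>u v. ip (B u) v = ip u (B v))"

text \<open>Over the complex numbers, positivity includes that the scalar in question is real.\<close>

definition positive_definite ::
  "('h::zero \<Rightarrow> 'h \<Rightarrow> 'k::real_algebra_1) \<Rightarrow> ('h \<Rightarrow> 'h) \<Rightarrow> bool" where
  "positive_definite ip B \<longleftrightarrow> (\<forall>u. u \<noteq> 0 \<longrightarrow> (\<exists>r>0. ip (B u) u = of_real r))"

definition weighted_ip :: "('h \<Rightarrow> 'h) \<Rightarrow> ('h \<Rightarrow> 'h \<Rightarrow> 'k) \<Rightarrow> 'h \<Rightarrow> 'h \<Rightarrow> 'k" where
  "weighted_ip B ip u v = ip (B u) v"

end

theory Submission
  imports Defs
begin

text \<open>
  With \<open>N = closure (ran \<Pi>)\<close>, the space is \<open>ker \<Gamma> + N\<close>, and \<open>ker \<Gamma> \<inter> N\<close> is the closure of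
  \<open>ran \<Gamma>\<close>. For the original and for the weighted inner product alike, the kernel of \<open>\<Gamma>\<close> plus its
  adjoint is the complement, orthogonal for that inner product, of \<open>closure (ran \<Gamma>)\<close> in \<open>ker \<Gamma>\<close>.
  So both kernels are complements of \<open>N\<close>, and on \<open>ker \<Gamma>\<close> the projections along \<open>N\<close> are the
  orthogonal projections for the respective inner products, which are bounded.
\<close>

section \<open>Scalars\<close>

text \<open>Taking norms in \<open>mult_scalar_cnj\<close> and cancelling \<open>norm a\<close>
  settles every nonzero \<open>a\<close>; at 0 additivity of the conjugation decides.\<close>

lemma norm_scalar_cnj: "norm (scalar_cnj a) = norm (a::'k::hilbert_scalar)"
proof (cases "a = 0")
  case True
  have "scalar_cnj (0::'k) + scalar_cnj 0 = scalar_cnj 0"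
    by (metis scalar_cnj_add add_0)
  with True show ?thesis by simp
next
  case False
  have "norm a * norm (scalar_cnj a) = norm a * norm a"
    by (metis norm_mult mult_scalar_cnj norm_scaleR norm_one mult_1_right abs_of_nonneg
        zero_le_power2 power2_eq_square)
  with False show ?thesis by simp
qed

lemma mult_scalar_cnj': "a * scalar_cnj a = of_real ((norm (a::'k::hilbert_scalar))\<^sup>2)"
  by (simp add: mult_scalar_cnj of_real_def)

lemma scalar_cnj_0 [simp]: "scalar_cnj (0::'k::hilbert_scalar) = 0"
  using norm_scalar_cnj[of "0::'k"] by simp

lemma scalar_cnj_eq_0_iff [simp]: "scalar_cnj a = 0 \<longleftrightarrow> a = (0::'k::hilbert_scalar)"
  by (metis norm_scalar_cnj norm_eq_zero)

lemma scalar_cnj_of_real [simp]: "scalar_cnj (of_real r) = (of_real r :: 'k::hilbert_scalar)"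
proof (cases "r = 0")
  case False
  have "of_real r * scalar_cnj (of_real r) = (of_real r * of_real r :: 'k)"
    unfolding mult_scalar_cnj' by (simp add: power2_eq_square)
  with False show ?thesis by simp
qed simp

section \<open>Positive forms\<close>

text \<open>Kept free of any norm or topology: the weighted form enters at this level first, and its
  own Cauchy-Schwarz inequality is then used to prove it coercive.\<close>

locale positive_form = vector_space scl
  for scl :: "'k::hilbert_scalar \<Rightarrow> 'h::ab_group_add \<Rightarrow> 'h" +
  fixes s :: "'h \<Rightarrow> 'h \<Rightarrow> 'k"
  assumes add_left: "s (x + y) z = s x z + s y z"
    and scale_left: "s (scl a x) y = a * s x y"
    and commute: "s x y = scalar_cnj (s y x)"
    and positive: "x \<noteq> 0 \<Longrightarrow> \<exists>r>0. s x x = of_real r"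
begin

definition q :: "'h \<Rightarrow> real" where "q x = norm (s x x)"

lemma zero_left [simp]: "s 0 y = 0"
  by (metis add_left add_0 add_cancel_left_left)

lemma zero_right [simp]: "s x 0 = 0"
  by (metis commute zero_left scalar_cnj_0)

lemma eq_0_commute: "s x y = 0 \<longleftrightarrow> s y x = 0"
  by (metis commute scalar_cnj_eq_0_iff)

lemma self: "s x x = of_real (q x)"
proof (cases "x = 0")
  case False
  then obtain r where "r > 0" "s x x = of_real r" using positive by blast
  then show ?thesis by (simp add: q_def)
qed (simp add: q_def)

lemma q_nonneg: "0 \<le> q x"
  by (simp add: q_def)

lemma q_pos: "x \<noteq> 0 \<Longrightarrow> 0 < q x"
  using positive[of x] by (auto simp: q_def)

lemma self_eq_0_iff: "s x x = 0 \<longleftrightarrow> x = 0"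
  using q_pos[of x] by (auto simp: q_def)

lemma add_right: "s x (y + z) = s x y + s x z"
  by (metis commute add_left scalar_cnj_add)

lemma scale_right: "s x (scl a y) = scalar_cnj a * s x y"
  by (metis commute scale_left scalar_cnj_mult)

lemma minus_left: "s (- x) y = - s x y"
  by (metis add_left zero_left add.right_inverse minus_unique)

lemma minus_right: "s x (- y) = - s x y"
  by (metis add_right zero_right add.right_inverse minus_unique)

lemma diff_left: "s (x - y) z = s x z - s y z"
  by (metis add_left minus_left diff_conv_add_uminus)

lemma diff_right: "s x (y - z) = s x y - s x z"
  by (metis add_right minus_right diff_conv_add_uminus)

lemma parallelogram: "q (x + y) + q (x - y) = 2 * q x + 2 * q y"
proof -
  have "s (x + y) (x + y) + s (x - y) (x - y) = 2 * s x x + 2 * s y y"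
    by (simp add: add_left add_right diff_left diff_right algebra_simps)
  then have "(of_real (q (x + y) + q (x - y)) :: 'k) = of_real (2 * q x + 2 * q y)"
    by (simp add: self)
  then show ?thesis unfolding of_real_eq_iff .
qed

lemma q_scale: "q (scl a x) = (norm a)\<^sup>2 * q x"
  by (simp add: q_def scale_left scale_right norm_mult norm_scalar_cnj power2_eq_square)

text \<open>The quadratic in \<open>e\<close> is minimal at \<open>e = 1 / q y\<close>.\<close>

lemma q_diff_scale:
  "q (x - scl (of_real e * s x y) y) = q x - 2 * e * (norm (s x y))\<^sup>2 + e\<^sup>2 * (norm (s x y))\<^sup>2 * q y"
proof -
  define t where "t = s x y"
  have t: "s y x = scalar_cnj t" unfolding t_def by (rule commute)
  have "s (x - scl (of_real e * t) y) (x - scl (of_real e * t) y) =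
      s x x - of_real (2 * e) * (t * scalar_cnj t) + of_real (e * e) * (t * scalar_cnj t) * s y y"
    by (simp add: diff_left diff_right scale_left scale_right scalar_cnj_mult t t_def[symmetric]
        algebra_simps)
  also have "\<dots> = of_real (q x - 2 * e * (norm t)\<^sup>2 + e\<^sup>2 * (norm t)\<^sup>2 * q y)"
    by (simp add: self mult_scalar_cnj' power2_eq_square)
  finally show ?thesis unfolding self of_real_eq_iff t_def .
qed

text \<open>This is the squared length left after removing from \<open>x\<close> its component along
  \<open>y\<close>. Its nonnegativity is Cauchy-Schwarz, and comparing it with a minimal distance
  yields orthogonality in \<open>projection_theorem\<close>.\<close>

lemma q_diff_optimal:
  assumes "y \<noteq> 0"
  shows "q (x - scl (of_real (1 / q y) * s x y) y) = q x - (norm (s x y))\<^sup>2 / q y"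
  unfolding q_diff_scale using q_pos[OF assms] by (simp add: field_simps power2_eq_square)

lemma Cauchy_Schwarz: "(norm (s x y))\<^sup>2 \<le> q x * q y"
proof (cases "y = 0")
  case False
  have "0 \<le> q x - (norm (s x y))\<^sup>2 / q y"
    using q_diff_optimal[OF False, of x] q_nonneg by metis
  with q_pos[OF False] show ?thesis by (simp add: field_simps)
qed (simp add: q_nonneg)

text \<open>The varying vector sits in the left slot, where the form is linear and, for coercive
  forms, shown continuous.\<close>

definition orth :: "'h set \<Rightarrow> 'h set" where
  "orth M = {x. \<forall>y\<in>M. s x y = 0}"

lemma subspace_orth: "subspace (orth M)"
  by (rule subspaceI) (auto simp: orth_def add_left scale_left)

end

section \<open>Forms whose length is equivalent to the norm\<close>

locale coercive_form = positive_form scl s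
  for scl :: "'k::hilbert_scalar \<Rightarrow> 'h::banach \<Rightarrow> 'h" and s +
  assumes scale_of_real: "scl (of_real r) x = r *\<^sub>R x"
    and coercive: "\<exists>c>0. \<forall>x. c * (norm x)\<^sup>2 \<le> norm (s x x)"
    and bounded: "\<exists>C>0. \<forall>x. norm (s x x) \<le> C * (norm x)\<^sup>2"
begin

text \<open>The two bounds on the form give \<open>K = sqrt (C / c)\<close>, independent of the
  vectors. This turns the fact that orthogonal projections do not increase \<open>q\<close> into a
  bound in the given norm.\<close>

lemma norm_le_of_q_le:
  obtains K where "K > 0" "\<And>x y. q x \<le> q y \<Longrightarrow> norm x \<le> K * norm y"
proof -
  obtain c C where c: "c > 0" "\<And>x. c * (norm x)\<^sup>2 \<le> q x"
    and C: "C > 0" "\<And>x. q x \<le> C * (norm x)\<^sup>2"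
    using coercive bounded unfolding q_def by blast
  have "norm x \<le> sqrt (C / c) * norm y" if "q x \<le> q y" for x y
  proof -
    have "c * (norm x)\<^sup>2 \<le> C * (norm y)\<^sup>2" using c(2)[of x] C(2)[of y] that by linarith
    then have "(norm x)\<^sup>2 \<le> C / c * (norm y)\<^sup>2" using c(1) by (simp add: field_simps)
    then have "sqrt ((norm x)\<^sup>2) \<le> sqrt (C / c * (norm y)\<^sup>2)" by (rule real_sqrt_le_mono)
    then show ?thesis by (simp add: real_sqrt_mult real_sqrt_divide)
  qed
  then show ?thesis using c(1) C(1) by (intro that[of "sqrt (C / c)"]) auto
qed

lemma bounded_linear_scale: "bounded_linear (scl a)"
proof -
  obtain K where K: "K > 0" "\<And>x y. q x \<le> q y \<Longrightarrow> norm x \<le> K * norm y"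
    using norm_le_of_q_le by blast
  show ?thesis
  proof (rule bounded_linear_intro)
    show "scl a (x + y) = scl a x + scl a y" for x y by (rule scale_right_distrib)
    show "scl a (r *\<^sub>R x) = r *\<^sub>R scl a x" for r x
      unfolding scale_of_real[symmetric] by (rule scale_left_commute)
    show "norm (scl a x) \<le> norm x * (K * norm a)" for x
    proof -
      \<comment> \<open>Scaling by \<open>a\<close> and by the real number \<open>norm a\<close>
        have the same effect on \<open>q\<close>.\<close>
      have "q (scl a x) = q (norm a *\<^sub>R x)"
        unfolding scale_of_real[symmetric] q_scale by simp
      then have "norm (scl a x) \<le> K * norm (norm a *\<^sub>R x)" by (intro K(2)) simp
      then show ?thesis by (simp add: mult_ac)
    qed
  qed
qed

lemma bounded_linear_left: "bounded_linear (\<lambda>x. s x y)"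
proof -
  obtain C where C: "C > 0" "\<And>x. q x \<le> C * (norm x)\<^sup>2"
    using bounded unfolding q_def by blast
  show ?thesis
  proof (rule bounded_linear_intro)
    show "s (x + x') y = s x y + s x' y" for x x' by (rule add_left)
    show "s (r *\<^sub>R x) y = r *\<^sub>R s x y" for r x
      unfolding scale_of_real[symmetric] scale_left by (simp add: scaleR_conv_of_real)
    show "norm (s x y) \<le> norm x * (C * norm y)" for x
    proof (rule power2_le_imp_le)
      have "(norm (s x y))\<^sup>2 \<le> (C * (norm x)\<^sup>2) * (C * (norm y)\<^sup>2)"
        using Cauchy_Schwarz[of x y] mult_mono[OF C(2)[of x] C(2)[of y]] C(1) q_nonneg
        by (smt (verit) mult_nonneg_nonneg zero_le_power2)
      then show "(norm (s x y))\<^sup>2 \<le> (norm x * (C * norm y))\<^sup>2"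
        by (simp add: power_mult_distrib power2_eq_square mult_ac)
    qed (use C(1) in auto)
  qed
qed

lemma continuous_on_left: "continuous_on A (\<lambda>x. s x y)"
  by (rule linear_continuous_on[OF bounded_linear_left])

lemma closed_orth: "closed (orth M)"
proof -
  have "orth M = (\<Inter>y\<in>M. {x. s x y = 0})" by (auto simp: orth_def)
  moreover have "closed {x. s x y = 0}" for y
    by (intro closed_Collect_eq continuous_on_left continuous_on_const)
  ultimately show ?thesis by auto
qed

text \<open>Orthogonality is symmetric, so the vectors orthogonal to \<open>x\<close> form the
  closed set \<open>orth {x}\<close>, which contains the closure of \<open>M\<close> as soon as it
  contains \<open>M\<close>.\<close>

lemma orth_closure: "orth (closure M) = orth M"
proof
  show "orth (closure M) \<subseteq> orth M" using closure_subset by (fastforce simp: orth_def)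
  show "orth M \<subseteq> orth (closure M)"
  proof
    fix x assume x: "x \<in> orth M"
    have "M \<subseteq> orth {x}" using x eq_0_commute by (auto simp: orth_def)
    then have "closure M \<subseteq> orth {x}" by (rule closure_minimal) (rule closed_orth)
    then show "x \<in> orth (closure M)" using eq_0_commute by (auto simp: orth_def)
  qed
qed

lemma subspace_closure: "subspace M \<Longrightarrow> subspace (closure M)"
proof (rule subspaceI)
  assume M: "subspace M"
  show "0 \<in> closure M" using subspace_0[OF M] closure_subset by blast
  fix x y assume "x \<in> closure M" "y \<in> closure M"
  then obtain f g where f: "\<And>n. f n \<in> M" "f \<longlonglongrightarrow> x" and g: "\<And>n. g n \<in> M" "g \<longlonglongrightarrow> y"
    unfolding closure_sequential by blast
  then show "x + y \<in> closure M" unfolding closure_sequential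
    by (intro exI[of _ "\<lambda>n. f n + g n"]) (auto intro: subspace_add[OF M] tendsto_intros)
  show "scl a x \<in> closure M" for a unfolding closure_sequential using f
    by (intro exI[of _ "\<lambda>n. scl a (f n)"])
      (auto intro: subspace_scale[OF M] bounded_linear.tendsto[OF bounded_linear_scale])
qed

text \<open>The difference \<open>v - w\<close> is orthogonal to a dense set, hence to itself. This
  is what makes the value of an adjoint unique.\<close>

lemma dense_ext:
  assumes "closure D = UNIV" and "\<And>u. u \<in> D \<Longrightarrow> s u v = s u w"
  shows "v = w"
proof -
  have "v - w \<in> orth D" using assms(2) eq_0_commute by (auto simp: orth_def diff_right)
  then have "v - w \<in> orth UNIV" unfolding assms(1)[symmetric] orth_closure .
  then have "s (v - w) (v - w) = 0" by (auto simp: orth_def)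
  then show ?thesis by (simp add: self_eq_0_iff)
qed

section \<open>Orthogonal projection onto a closed subspace\<close>

lemma projection_theorem:
  assumes M: "subspace M" "closed M"
  obtains m n where "x = m + n" "m \<in> M" "n \<in> orth M"
proof -
  define d where "d = (INF m\<in>M. q (x - m))"
  have ne: "(\<lambda>m. q (x - m)) ` M \<noteq> {}" using subspace_0[OF M(1)] by blast
  have bdd: "bdd_below ((\<lambda>m. q (x - m)) ` M)"
    by (rule bdd_belowI[of _ 0]) (auto simp: q_nonneg)
  have d_le: "d \<le> q (x - m)" if "m \<in> M" for m
    unfolding d_def using bdd that by (rule cINF_lower)
  have "\<exists>m\<in>M. q (x - m) < d + inverse (Suc n)" for n
    using cINF_less_iff[OF _ bdd, of "d + inverse (Suc n)"] ne unfolding d_def by auto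
  then obtain f where f: "\<And>n. f n \<in> M" "\<And>n. q (x - f n) < d + inverse (Suc n)" by metis
  obtain c where c: "c > 0" "\<And>x. c * (norm x)\<^sup>2 \<le> q x" using coercive unfolding q_def by blast
  have key: "q (f k - f l) \<le> 2 * inverse (Suc k) + 2 * inverse (Suc l)" for k l
  proof -
    \<comment> \<open>The midpoint stays in \<open>M\<close>, so its distance to \<open>x\<close> is
      bounded below by \<open>d\<close>; the parallelogram identity then forces two near-minimizers
      to be close.\<close>
    define m where "m = (1/2) *\<^sub>R (f k + f l)"
    have "m \<in> M" unfolding m_def scale_of_real[symmetric]
      by (intro subspace_scale subspace_add M f)
    have e: "(x - f l) + (x - f k) = scl (of_real 2) (x - m)"
      unfolding scale_of_real m_def by (simp add: algebra_simps scaleR_2)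
    have "4 * q (x - m) + q (f k - f l) = 2 * q (x - f l) + 2 * q (x - f k)"
      using parallelogram[of "x - f l" "x - f k"] unfolding e q_scale by simp
    then show ?thesis using d_le[OF \<open>m \<in> M\<close>] f(2)[of k] f(2)[of l] by linarith
  qed
  have "Cauchy f"
  proof (rule metric_CauchyI)
    fix e :: real assume e: "e > 0"
    \<comment> \<open>The factor 4 absorbs the two summands of \<open>key\<close>, each at most
      \<open>2 * inverse (Suc N)\<close>.\<close>
    then obtain N where N: "inverse (Suc N) < c * e\<^sup>2 / 4"
      using reals_Archimedean[of "c * e\<^sup>2 / 4"] c(1) by auto
    have "dist (f k) (f l) < e" if "k \<ge> N" "l \<ge> N" for k l
    proof -
      have "inverse (real (Suc k)) \<le> inverse (Suc N)" "inverse (real (Suc l)) \<le> inverse (Suc N)"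
        using that by (auto intro: le_imp_inverse_le)
      then have "c * (norm (f k - f l))\<^sup>2 < c * e\<^sup>2"
        using key[of k l] c(2)[of "f k - f l"] N by linarith
      then have "(norm (f k - f l))\<^sup>2 < e\<^sup>2" using c(1) by simp
      then show ?thesis using e by (simp add: dist_norm power2_less_imp_less)
    qed
    then show "\<exists>N. \<forall>k\<ge>N. \<forall>l\<ge>N. dist (f k) (f l) < e" by blast
  qed
  then obtain m where m: "f \<longlonglongrightarrow> m" using Cauchy_convergent convergent_def by blast
  have mM: "m \<in> M" using closed_sequentially[OF M(2) _ m] f(1) by blast
  have "s (x - m) y = 0" if "y \<in> M" for y
  proof (cases "y = 0")
    case False
    have "(norm (s (x - f n) y))\<^sup>2 \<le> q y * inverse (real (Suc n))" for n
    proof -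
      \<comment> \<open>Here \<open>z\<close> is the component of \<open>x - f n\<close> along
        \<open>y\<close>. As \<open>f n + z\<close> lies in \<open>M\<close>, removing
        \<open>z\<close> cannot push the squared distance below \<open>d\<close>, so
        \<open>x - f n\<close> is nearly orthogonal to \<open>y\<close>; the limit gives exact
        orthogonality.\<close>
      define z where "z = scl (of_real (1 / q y) * s (x - f n) y) y"
      have "d \<le> q (x - f n - z)"
        using d_le[OF subspace_add[OF M(1) f(1)[of n] subspace_scale[OF M(1) that]]]
        by (simp add: z_def diff_diff_eq)
      also have "\<dots> = q (x - f n) - (norm (s (x - f n) y))\<^sup>2 / q y"
        unfolding z_def by (rule q_diff_optimal[OF False])
      finally have "(norm (s (x - f n) y))\<^sup>2 / q y \<le> inverse (real (Suc n))"
        using f(2)[of n] by linarith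
      then show ?thesis using q_pos[OF False] by (simp add: pos_divide_le_eq mult.commute)
    qed
    moreover have "(\<lambda>n. (norm (s (x - f n) y))\<^sup>2) \<longlonglongrightarrow> (norm (s (x - m) y))\<^sup>2"
      by (intro tendsto_power tendsto_norm bounded_linear.tendsto[OF bounded_linear_left]
          tendsto_diff tendsto_const m)
    moreover have "(\<lambda>n. q y * inverse (real (Suc n))) \<longlonglongrightarrow> q y * 0"
      by (intro tendsto_mult tendsto_const LIMSEQ_inverse_real_of_nat)
    ultimately have "(norm (s (x - m) y))\<^sup>2 \<le> q y * 0"
      using LIMSEQ_le by blast
    then show ?thesis by simp
  qed simp
  then show ?thesis using mM by (intro that[of m "x - m"]) (auto simp: orth_def)
qed

end


section \<open>Complementary subspaces\<close>

context coercive_form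
begin

lemma proj_along_eq:
  assumes "direct_sum scl M N" "m \<in> M" "x - m \<in> N"
  shows "proj_along M N x = m"
  unfolding proj_along_def
proof (rule the_equality)
  fix m' assume m': "m' \<in> M \<and> x - m' \<in> N"
  have MN: "subspace M" "subspace N" "M \<inter> N = {0}" using assms(1) by (auto simp: direct_sum_def)
  have "m' - m \<in> M" using MN(1) m' assms(2) by (blast intro: subspace_diff)
  moreover have "(x - m) - (x - m') \<in> N" using MN(2) m' assms(3) by (blast intro: subspace_diff)
  ultimately have "m' - m \<in> M \<inter> N" by simp
  with MN(3) show "m' = m" by simp
qed (use assms in blast)

lemma proj_along_mem:
  assumes "direct_sum scl M N"
  shows "proj_along M N x \<in> M" "x - proj_along M N x \<in> N"
proof -
  obtain m n where "m \<in> M" "n \<in> N" "x = m + n" using assms by (meson direct_sum_def)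
  moreover from this have "proj_along M N x = m" by (intro proj_along_eq[OF assms]) auto
  ultimately show "proj_along M N x \<in> M" "x - proj_along M N x \<in> N" by auto
qed

lemma proj_along_add:
  assumes "direct_sum scl M N"
  shows "proj_along M N (x + y) = proj_along M N x + proj_along M N y"
proof (rule proj_along_eq[OF assms])
  note mem = proj_along_mem[OF assms]
  have MN: "subspace M" "subspace N" using assms by (auto simp: direct_sum_def)
  show "proj_along M N x + proj_along M N y \<in> M" by (intro subspace_add MN mem)
  have "(x - proj_along M N x) + (y - proj_along M N y) \<in> N" by (intro subspace_add MN mem)
  then show "x + y - (proj_along M N x + proj_along M N y) \<in> N" by (simp add: algebra_simps)
qed

lemma proj_along_scale:
  assumes "direct_sum scl M N"
  shows "proj_along M N (scl a x) = scl a (proj_along M N x)"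
proof (rule proj_along_eq[OF assms])
  note mem = proj_along_mem[OF assms]
  have MN: "subspace M" "subspace N" using assms by (auto simp: direct_sum_def)
  show "scl a (proj_along M N x) \<in> M" by (intro subspace_scale MN mem)
  have "scl a (x - proj_along M N x) \<in> N" by (intro subspace_scale MN mem)
  then show "scl a x - scl a (proj_along M N x) \<in> N" by (simp add: scale_right_diff_distrib)
qed

text \<open>A vector of \<open>M\<close> and its projection to \<open>M'\<close> differ by an
  element of \<open>N\<close>, so the vector itself is what projecting back must return.\<close>

lemma proj_along_inverse:
  assumes "direct_sum scl M N" "direct_sum scl M' N" "x \<in> M"
  shows "proj_along M N (proj_along M' N x) = x"
proof (rule proj_along_eq[OF assms(1,3)])
  have "subspace N" using assms by (auto simp: direct_sum_def)
  from subspace_neg[OF this proj_along_mem(2)[OF assms(2)], of x]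
  show "proj_along M' N x - x \<in> N" by simp
qed

text \<open>Differences of points of \<open>A\<close> stay in \<open>A\<close>, so by linearity a
  bound on \<open>A\<close> alone gives a Lipschitz estimate there. The absolute value guards
  against a negative \<open>K\<close>.\<close>

lemma continuous_on_proj_along:
  assumes "direct_sum scl M N" "subspace A" "\<And>x. x \<in> A \<Longrightarrow> norm (proj_along M N x) \<le> K * norm x"
  shows "continuous_on A (proj_along M N)"
proof (rule lipschitz_on_continuous_on[where L = "\<bar>K\<bar>"], rule lipschitz_onI)
  fix x y assume xy: "x \<in> A" "y \<in> A"
  have "proj_along M N x - proj_along M N y = proj_along M N (x - y)"
    using proj_along_add[OF assms(1), of "x - y" y] by simp
  also have "norm \<dots> \<le> K * norm (x - y)" by (intro assms(3) subspace_diff assms(2) xy)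
  also have "\<dots> \<le> \<bar>K\<bar> * norm (x - y)" by (intro mult_right_mono) auto
  finally show "dist (proj_along M N x) (proj_along M N y) \<le> \<bar>K\<bar> * dist x y"
    by (simp add: dist_norm)
qed simp

lemma isomorphism_proj_along:
  assumes M: "direct_sum scl M N" and M': "direct_sum scl M' N"
    and K: "\<And>x. x \<in> M \<Longrightarrow> norm (proj_along M' N x) \<le> K * norm x"
    and K': "\<And>x. x \<in> M' \<Longrightarrow> norm (proj_along M N x) \<le> K' * norm x"
  shows "isomorphism_on scl M M' (proj_along M' N)"
    and "\<And>v. v \<in> M' \<Longrightarrow> inv_into M (proj_along M' N) v = proj_along M N v"
proof -
  let ?P = "proj_along M' N" and ?Q = "proj_along M N"
  have sub: "subspace M" "subspace M'" using M M' by (auto simp: direct_sum_def)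
  have bij: "bij_betw ?P M M'"
    by (rule bij_betwI[where g = ?Q])
      (auto simp: proj_along_mem[OF M] proj_along_mem[OF M'] proj_along_inverse[OF M M']
        proj_along_inverse[OF M' M])
  show inv: "inv_into M ?P v = ?Q v" if "v \<in> M'" for v
    using that bij
    by (intro inv_into_f_eq)
      (auto simp: bij_betw_def proj_along_mem[OF M] proj_along_inverse[OF M' M])
  have "continuous_on M ?P" "continuous_on M' ?Q"
    using continuous_on_proj_along[OF M' sub(1)] continuous_on_proj_along[OF M sub(2)] K K' by blast+
  then have "homeomorphism M M' ?P ?Q"
    by (intro homeomorphismI)
      (auto simp: proj_along_mem[OF M] proj_along_mem[OF M'] proj_along_inverse[OF M M']
        proj_along_inverse[OF M' M])
  \<comment> \<open>The notion of isomorphism is phrased with \<open>inv_into\<close>, which agrees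
    with \<open>?Q\<close> on \<open>M'\<close>.\<close>
  then have "homeomorphism M M' ?P (inv_into M ?P)"
    by (rule homeomorphism_cong) (auto simp: inv)
  then show "isomorphism_on scl M M' ?P"
    using sub bij by (simp add: isomorphism_on_def linear_on_def proj_along_add[OF M']
        proj_along_scale[OF M'])
qed

end

section \<open>Hilbert spaces\<close>

lemma (in hilbert_space) norm_ip_self: "norm (ip x x) = (norm x)\<^sup>2"
  unfolding ip_self norm_of_real by simp

lemma (in hilbert_space) coercive_form_ip: "coercive_form scl ip"
proof
  show "\<exists>r>0. ip x x = of_real r" if "x \<noteq> 0" for x
    using that ip_self[of x] by (intro exI[of _ "(norm x)\<^sup>2"]) auto
  show "\<exists>c>0. \<forall>x. c * (norm x)\<^sup>2 \<le> norm (ip x x)" "\<exists>C>0. \<forall>x. norm (ip x x) \<le> C * (norm x)\<^sup>2"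
    by (auto simp: norm_ip_self intro!: exI[of _ "1::real"])
qed (fact ip_add_left ip_scale_left ip_commute scale_of_real)+

lemma (in hilbert_space) norm_ip_le: "norm (ip x y) \<le> norm x * norm y"
proof -
  interpret coercive_form scl ip by (rule coercive_form_ip)
  have "(norm (ip x y))\<^sup>2 \<le> (norm x * norm y)\<^sup>2"
    using Cauchy_Schwarz[of x y] by (simp add: q_def norm_ip_self power_mult_distrib)
  then show ?thesis by (rule power2_le_imp_le) simp
qed

text \<open>The product norm is the Euclidean one, so it comes from the sum of the two inner
  products. Orthogonal projection onto the graph of an operator takes place in this space.\<close>

lemma hilbert_space_prod:
  assumes "hilbert_space scl ip"
  shows "hilbert_space (\<lambda>a z. (scl a (fst z), scl a (snd z)))
    (\<lambda>z w. ip (fst z) (fst w) + ip (snd z) (snd w))"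
proof -
  interpret hilbert_space scl ip by fact
  show ?thesis
  proof
    show "ip (fst x) (fst y) + ip (snd x) (snd y) =
        scalar_cnj (ip (fst y) (fst x) + ip (snd y) (snd x))" for x y
      unfolding scalar_cnj_add by (metis ip_commute)
    show "ip (fst x) (fst x) + ip (snd x) (snd x) = of_real ((norm x)\<^sup>2)" for x
      by (cases x) (simp add: ip_self norm_Pair)
  qed (simp_all add: prod_eq_iff scale_right_distrib scale_left_distrib scale_of_real ip_add_left
      ip_scale_left algebra_simps)
qed

text \<open>Positive definiteness alone gives no uniform lower bound in infinite dimension. That
  bound comes from continuity of the inverse of \<open>B\<close>, combined with Cauchy-Schwarz for
  the weighted form.\<close>

lemma coercive_form_weighted_ip:
  assumes "hilbert_space scl ip" and "bounded_linear B" and "isomorphism_on scl UNIV UNIV B"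
    and "self_adjoint_map ip B" and "positive_definite ip B"
  shows "coercive_form scl (weighted_ip B ip)"
proof -
  interpret hilbert_space scl ip by fact
  interpret B: bounded_linear B by fact
  have iso: "inj B" "continuous_on UNIV (inv B)" "\<And>a x. B (scl a x) = scl a (B x)"
    using assms(3) by (auto simp: isomorphism_on_def linear_on_def bij_betw_def homeomorphism_def)
  have B_eq_0: "B x = 0 \<longleftrightarrow> x = 0" for x
    using iso(1) B.zero by (metis injD)
  interpret W: positive_form scl "weighted_ip B ip"
  proof
    show "weighted_ip B ip x y = scalar_cnj (weighted_ip B ip y x)" for x y
      using assms(4) unfolding self_adjoint_map_def weighted_ip_def by (metis ip_commute)
    show "\<exists>r>0. weighted_ip B ip x x = of_real r" if "x \<noteq> 0" for x
      using assms(5) that unfolding positive_definite_def weighted_ip_def by blast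
  qed (simp_all add: weighted_ip_def B.add iso(3) ip_add_left ip_scale_left)
  obtain K where K: "K > 0" "\<And>x. norm (B x) \<le> norm x * K" using B.pos_bounded by blast
  have upper: "W.q x \<le> K * (norm x)\<^sup>2" for x
  proof -
    have "W.q x \<le> norm (B x) * norm x"
      unfolding W.q_def weighted_ip_def by (rule norm_ip_le)
    also have "\<dots> \<le> (norm x * K) * norm x" by (intro mult_right_mono K) auto
    finally show ?thesis by (simp add: power2_eq_square mult_ac)
  qed
  obtain d where d: "d > 0" "\<And>x. d * norm x \<le> norm (B x)"
  proof -
    have "continuous (at 0) (inv B)" using iso(2) by (simp add: continuous_on_eq_continuous_at)
    have inv: "inv B (B x) = x" for x using iso(1) by simp
    obtain e where e: "e > 0" "\<And>y. norm y < e \<Longrightarrow> norm (inv B y) < 1"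
    proof -
      have "inv B 0 = 0" using inv[of 0] by (simp add: B.zero)
      moreover obtain e where "e > 0" "\<And>y. dist y 0 < e \<Longrightarrow> dist (inv B y) (inv B 0) < 1"
        using \<open>continuous (at 0) (inv B)\<close> zero_less_one unfolding continuous_at_eps_delta by blast
      ultimately show thesis by (intro that[of e]) auto
    qed
    have "e / 2 * norm x \<le> norm (B x)" for x
    proof (cases "x = 0")
      case False
      then have pos: "norm (B x) > 0" by (simp add: B_eq_0)
      \<comment> \<open>With this factor \<open>B (r *\<^sub>R x)\<close> has norm
        \<open>e / 2\<close>, inside the ball that \<open>inv B\<close> maps into the unit
        ball.\<close>
      define r where "r = e / (2 * norm (B x))"
      have "r > 0" using pos e(1) by (simp add: r_def)
      have "norm (B (r *\<^sub>R x)) < e" using pos e(1) \<open>r > 0\<close> by (simp add: B.scaleR r_def)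
      from e(2)[OF this] have "r * norm x < 1" using \<open>r > 0\<close> by (simp add: inv)
      then show ?thesis using pos by (simp add: r_def field_simps)
    qed simp
    then show thesis using e(1) by (intro that[of "e / 2"]) auto
  qed
  text \<open>Cauchy--Schwarz for the weighted form at \<open>x\<close> and \<open>B x\<close> gives \<open>\<parallel>B x\<parallel>\<^sup>2 \<le> K \<langle>B x, x\<rangle>\<close>.\<close>
  have lower: "d\<^sup>2 / K * (norm x)\<^sup>2 \<le> W.q x" for x
  proof (cases "x = 0")
    case False
    then have pos: "(norm (B x))\<^sup>2 > 0" by (simp add: B_eq_0)
    have "((norm (B x))\<^sup>2)\<^sup>2 \<le> W.q x * W.q (B x)"
      using W.Cauchy_Schwarz[of x "B x"] by (simp add: weighted_ip_def norm_ip_self)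
    also have "\<dots> \<le> W.q x * (K * (norm (B x))\<^sup>2)"
      by (intro mult_left_mono upper W.q_nonneg)
    finally have "(norm (B x))\<^sup>2 * (norm (B x))\<^sup>2 \<le> (W.q x * K) * (norm (B x))\<^sup>2"
      unfolding power2_eq_square[of "(norm (B x))\<^sup>2"] by (simp only: mult.assoc)
    then have "(norm (B x))\<^sup>2 \<le> W.q x * K"
      using pos by (rule mult_right_le_imp_le)
    moreover have "(d * norm x)\<^sup>2 \<le> (norm (B x))\<^sup>2" using d by (intro power_mono) auto
    ultimately show ?thesis using K(1) by (simp add: field_simps power_mult_distrib)
  qed (simp add: W.q_nonneg)
  show ?thesis
  proof
    show "\<exists>c>0. \<forall>x. c * (norm x)\<^sup>2 \<le> norm (weighted_ip B ip x x)"
      using lower d(1) K(1) unfolding W.q_def by (intro exI[of _ "d\<^sup>2 / K"]) auto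
    show "\<exists>C>0. \<forall>x. norm (weighted_ip B ip x x) \<le> C * (norm x)\<^sup>2"
      using upper K(1) unfolding W.q_def by blast
  qed (fact scale_of_real)
qed

section \<open>Nilpotent operators\<close>

text \<open>The form is a parameter so that one operator can be paired with \<open>ip\<close> and
  with the weighted form. The adjoint changes with the form; the kernel and range of
  \<open>\<Gamma>\<close> do not.\<close>

locale nilpotent_operator = coercive_form scl s
  for scl :: "'k::hilbert_scalar \<Rightarrow> 'h::banach \<Rightarrow> 'h" and s +
  fixes \<Gamma> :: "'h unbounded_op"
  assumes linear: "linear_op scl \<Gamma>" and closed: "closed_op \<Gamma>" and dense: "densely_defined \<Gamma>"
    and nilpotent: "nilpotent_op \<Gamma>"
begin

abbreviation "adj \<equiv> op_adjoint s \<Gamma>"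

lemma subspace_dom: "subspace (op_dom \<Gamma>)"
  using linear by (simp add: linear_op_def linear_on_def)

lemma app_add: "u \<in> op_dom \<Gamma> \<Longrightarrow> v \<in> op_dom \<Gamma> \<Longrightarrow> op_app \<Gamma> (u + v) = op_app \<Gamma> u + op_app \<Gamma> v"
  using linear by (simp add: linear_op_def linear_on_def)

lemma app_scale: "u \<in> op_dom \<Gamma> \<Longrightarrow> op_app \<Gamma> (scl a u) = scl a (op_app \<Gamma> u)"
  using linear by (simp add: linear_op_def linear_on_def)

lemma app_0: "op_app \<Gamma> 0 = 0"
  using app_scale[OF subspace_0[OF subspace_dom], of 0] by simp

lemma app_in_ker: "u \<in> op_dom \<Gamma> \<Longrightarrow> op_app \<Gamma> u \<in> op_ker \<Gamma>"
  using nilpotent by (auto simp: nilpotent_op_def op_ran_def)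

lemma subspace_ker: "subspace (op_ker \<Gamma>)"
  by (rule subspaceI)
    (auto simp: op_ker_def app_0 app_add app_scale subspace_0[OF subspace_dom]
      subspace_add[OF subspace_dom] subspace_scale[OF subspace_dom])

lemma subspace_ran: "subspace (op_ran \<Gamma>)"
proof (rule subspaceI)
  show "0 \<in> op_ran \<Gamma>" unfolding op_ran_def using app_0 subspace_0[OF subspace_dom] by (metis imageI)
  fix x y assume "x \<in> op_ran \<Gamma>" "y \<in> op_ran \<Gamma>"
  then obtain u v where uv: "u \<in> op_dom \<Gamma>" "x = op_app \<Gamma> u" "v \<in> op_dom \<Gamma>" "y = op_app \<Gamma> v"
    by (auto simp: op_ran_def)
  show "x + y \<in> op_ran \<Gamma>" unfolding op_ran_def
    by (rule image_eqI[of _ _ "u + v"]) (auto simp: uv app_add subspace_add[OF subspace_dom])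
  show "scl a x \<in> op_ran \<Gamma>" for a unfolding op_ran_def
    by (rule image_eqI[of _ _ "scl a u"]) (auto simp: uv app_scale subspace_scale[OF subspace_dom])
qed

text \<open>The kernel is the preimage of the closed graph under the continuous map sending
  \<open>u\<close> to \<open>(u, 0)\<close>.\<close>

lemma closed_ker: "Topological_Spaces.closed (op_ker \<Gamma>)"
proof -
  have "op_ker \<Gamma> = (\<lambda>u. (u, 0)) -` {(u, op_app \<Gamma> u) | u. u \<in> op_dom \<Gamma>}"
    by (auto simp: op_ker_def)
  also have "Topological_Spaces.closed \<dots>"
    by (rule closed_vimage[OF closed[unfolded closed_op_def]]) (intro continuous_intros)
  finally show ?thesis .
qed

lemma closure_ran_subset_ker: "closure (op_ran \<Gamma>) \<subseteq> op_ker \<Gamma>"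
  using nilpotent closed_ker by (simp add: nilpotent_op_def closure_minimal)

section \<open>The adjoint and the kernel of the sum\<close>

lemma adj_eq:
  assumes "\<And>u. u \<in> op_dom \<Gamma> \<Longrightarrow> s (op_app \<Gamma> u) v = s u w"
  shows "v \<in> op_dom adj" "op_app adj v = w"
proof -
  show "v \<in> op_dom adj" using assms by (auto simp: op_adjoint_def op_dom_def)
  have "(THE w. \<forall>u\<in>op_dom \<Gamma>. s (op_app \<Gamma> u) v = s u w) = w"
  proof (rule the_equality)
    fix w' assume "\<forall>u\<in>op_dom \<Gamma>. s (op_app \<Gamma> u) v = s u w'"
    with assms show "w' = w"
      using dense by (intro dense_ext[of "op_dom \<Gamma>"]) (auto simp: densely_defined_def)
  qed (use assms in blast)
  then show "op_app adj v = w" by (simp add: op_adjoint_def op_app_def)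
qed

lemma adj:
  assumes "v \<in> op_dom adj" "u \<in> op_dom \<Gamma>"
  shows "s (op_app \<Gamma> u) v = s u (op_app adj v)"
proof -
  obtain w where w: "\<And>u. u \<in> op_dom \<Gamma> \<Longrightarrow> s (op_app \<Gamma> u) v = s u w"
    using assms(1) by (auto simp: op_adjoint_def op_dom_def)
  with adj_eq(2)[OF w] assms(2) show ?thesis by simp
qed

text \<open>That \<open>v\<close> is orthogonal to every \<open>op_app \<Gamma> u\<close> is the
  defining relation of the adjoint with value 0.\<close>

lemma ker_adj: "op_ker adj = orth (op_ran \<Gamma>)"
proof
  show "op_ker adj \<subseteq> orth (op_ran \<Gamma>)"
    using adj eq_0_commute by (fastforce simp: op_ker_def orth_def op_ran_def)
  show "orth (op_ran \<Gamma>) \<subseteq> op_ker adj"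
  proof
    fix v assume "v \<in> orth (op_ran \<Gamma>)"
    then have "s (op_app \<Gamma> u) v = s u 0" if "u \<in> op_dom \<Gamma>" for u
      using that eq_0_commute by (auto simp: orth_def op_ran_def)
    from adj_eq[OF this] show "v \<in> op_ker adj" by (simp add: op_ker_def)
  qed
qed

text \<open>If the adjoint sends \<open>v\<close> to \<open>- op_app \<Gamma> v\<close>, pair this
  value with \<open>op_app \<Gamma> v\<close>: moving the adjoint across applies \<Gamma> twice,
  which is 0 by nilpotency. Hence \<open>op_app \<Gamma> v\<close> has length 0 and both terms of
  the sum vanish separately.\<close>

lemma ker_sum_adj: "op_ker (op_sum \<Gamma> adj) = op_ker \<Gamma> \<inter> orth (op_ran \<Gamma>)"
proof
  show "op_ker \<Gamma> \<inter> orth (op_ran \<Gamma>) \<subseteq> op_ker (op_sum \<Gamma> adj)"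
    unfolding ker_adj[symmetric] by (auto simp: op_ker_def op_sum_def op_dom_def op_app_def)
  show "op_ker (op_sum \<Gamma> adj) \<subseteq> op_ker \<Gamma> \<inter> orth (op_ran \<Gamma>)"
  proof
    fix v assume "v \<in> op_ker (op_sum \<Gamma> adj)"
    then have v: "v \<in> op_dom \<Gamma>" "v \<in> op_dom adj" "op_app adj v = - op_app \<Gamma> v"
      by (auto simp: op_ker_def op_sum_def op_dom_def op_app_def add_eq_0_iff)
    have "s (op_app \<Gamma> v) (op_app adj v) = s (op_app \<Gamma> (op_app \<Gamma> v)) v"
      by (rule adj[OF v(2), symmetric]) (use app_in_ker[OF v(1)] in \<open>simp add: op_ker_def\<close>)
    also have "\<dots> = 0" using app_in_ker[OF v(1)] by (simp add: op_ker_def)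
    finally have "op_app \<Gamma> v = 0" by (simp add: v(3) minus_right self_eq_0_iff)
    with v have "v \<in> op_ker \<Gamma>" "v \<in> op_ker adj" by (auto simp: op_ker_def)
    then show "v \<in> op_ker \<Gamma> \<inter> orth (op_ran \<Gamma>)" by (simp add: ker_adj)
  qed
qed

lemma subspace_ker_sum: "subspace (op_ker (op_sum \<Gamma> adj))"
  unfolding ker_sum_adj by (intro subspace_inter subspace_ker subspace_orth)

lemma closed_ker_sum: "Topological_Spaces.closed (op_ker (op_sum \<Gamma> adj))"
  unfolding ker_sum_adj by (intro closed_Int closed_ker closed_orth)

lemma ker_sum_closure_ran:
  assumes "x \<in> op_ker (op_sum \<Gamma> adj)" "x \<in> closure (op_ran \<Gamma>)"
  shows "x = 0"
proof -
  have "x \<in> orth (closure (op_ran \<Gamma>))" using assms(1) by (simp add: ker_sum_adj orth_closure)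
  with assms(2) have "s x x = 0" by (auto simp: orth_def)
  then show ?thesis by (simp add: self_eq_0_iff)
qed

text \<open>Project orthogonally onto the closure of the range. That closure lies in the kernel of
  \<Gamma>, so the remainder \<open>p\<close> does too, and Pythagoras bounds its length.\<close>

lemma hodge_ker:
  assumes "x \<in> op_ker \<Gamma>"
  obtains p g where "x = p + g" "p \<in> op_ker (op_sum \<Gamma> adj)" "g \<in> closure (op_ran \<Gamma>)" "q p \<le> q x"
proof -
  obtain g p where gp: "x = g + p" "g \<in> closure (op_ran \<Gamma>)" "p \<in> orth (closure (op_ran \<Gamma>))"
    using projection_theorem[OF subspace_closure[OF subspace_ran] closed_closure] by blast
  have "g \<in> op_ker \<Gamma>" using gp(2) closure_ran_subset_ker by blast
  then have "x - g \<in> op_ker \<Gamma>" using assms by (intro subspace_diff subspace_ker)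
  then have p: "p \<in> op_ker (op_sum \<Gamma> adj)" using gp by (simp add: ker_sum_adj orth_closure)
  have "s p g = 0" using gp by (simp add: orth_def)
  then have "s x x = s p p + s g g" unfolding gp(1) using eq_0_commute[of p g]
    by (simp add: add_left add_right)
  then have "(of_real (q x) :: 'k) = of_real (q p + q g)" by (simp add: self)
  then have "q x = q p + q g" unfolding of_real_eq_iff .
  then show ?thesis using gp p q_nonneg[of g] by (intro that[of p g]) (auto simp: add.commute)
qed

section \<open>Ranges of the adjoint and of the sum\<close>

lemma adj_add:
  assumes "u \<in> op_dom adj" "v \<in> op_dom adj"
  shows "u + v \<in> op_dom adj" "op_app adj (u + v) = op_app adj u + op_app adj v"
proof -
  have "s (op_app \<Gamma> x) (u + v) = s x (op_app adj u + op_app adj v)" if "x \<in> op_dom \<Gamma>" for x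
    using that by (simp add: add_right adj assms)
  from adj_eq[OF this] show "u + v \<in> op_dom adj"
    "op_app adj (u + v) = op_app adj u + op_app adj v" by blast+
qed

lemma adj_scale:
  assumes "u \<in> op_dom adj"
  shows "scl a u \<in> op_dom adj" "op_app adj (scl a u) = scl a (op_app adj u)"
proof -
  have "s (op_app \<Gamma> x) (scl a u) = s x (scl a (op_app adj u))" if "x \<in> op_dom \<Gamma>" for x
    using that by (simp add: scale_right adj assms)
  from adj_eq[OF this] show "scl a u \<in> op_dom adj"
    "op_app adj (scl a u) = scl a (op_app adj u)" by blast+
qed

lemma adj_0: "0 \<in> op_dom adj" "op_app adj 0 = 0"
  using adj_eq[of 0 0] by simp_all

lemma subspace_dom_adj: "subspace (op_dom adj)"
  by (rule subspaceI) (auto simp: adj_0 adj_add adj_scale)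

lemma subspace_ran_adj: "subspace (op_ran adj)"
proof (rule subspaceI)
  show "0 \<in> op_ran adj" unfolding op_ran_def using adj_0 by (metis imageI)
  fix x y assume "x \<in> op_ran adj" "y \<in> op_ran adj"
  then obtain u v where uv: "u \<in> op_dom adj" "x = op_app adj u" "v \<in> op_dom adj" "y = op_app adj v"
    by (auto simp: op_ran_def)
  show "x + y \<in> op_ran adj" unfolding op_ran_def
    by (rule image_eqI[of _ _ "u + v"]) (auto simp: uv adj_add)
  show "scl a x \<in> op_ran adj" for a unfolding op_ran_def
    by (rule image_eqI[of _ _ "scl a u"]) (auto simp: uv adj_scale)
qed

lemma ran_sumI:
  assumes "u \<in> op_dom \<Gamma>" "u \<in> op_dom adj" "y = op_app \<Gamma> u + op_app adj u"
  shows "y \<in> op_ran (op_sum \<Gamma> adj)"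
  using assms by (auto simp: op_ran_def op_sum_def op_dom_def op_app_def)

lemma ran_sumE:
  assumes "y \<in> op_ran (op_sum \<Gamma> adj)"
  obtains u where "u \<in> op_dom \<Gamma>" "u \<in> op_dom adj" "y = op_app \<Gamma> u + op_app adj u"
  using assms by (auto simp: op_ran_def op_sum_def op_dom_def op_app_def)

lemma subspace_ran_sum: "subspace (op_ran (op_sum \<Gamma> adj))"
proof (rule subspaceI)
  show "0 \<in> op_ran (op_sum \<Gamma> adj)"
    by (rule ran_sumI[of 0]) (auto simp: adj_0 app_0 subspace_0[OF subspace_dom])
  fix x y assume x: "x \<in> op_ran (op_sum \<Gamma> adj)" and y: "y \<in> op_ran (op_sum \<Gamma> adj)"
  obtain u where u: "u \<in> op_dom \<Gamma>" "u \<in> op_dom adj" "x = op_app \<Gamma> u + op_app adj u"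
    using x by (rule ran_sumE)
  obtain v where v: "v \<in> op_dom \<Gamma>" "v \<in> op_dom adj" "y = op_app \<Gamma> v + op_app adj v"
    using y by (rule ran_sumE)
  show "x + y \<in> op_ran (op_sum \<Gamma> adj)"
    by (rule ran_sumI[of "u + v"])
      (auto simp: u v adj_add app_add subspace_add[OF subspace_dom] algebra_simps)
  show "scl a x \<in> op_ran (op_sum \<Gamma> adj)" for a
    by (rule ran_sumI[of "scl a u"])
      (auto simp: u adj_scale app_scale subspace_scale[OF subspace_dom] scale_right_distrib)
qed

text \<open>Nilpotency passes to the adjoint: pairing \<open>op_app adj v\<close> with
  \<open>op_app \<Gamma> u\<close> moves \<Gamma> onto \<open>op_app \<Gamma> u\<close>, where it
  gives 0.\<close>

lemma ran_adj_subset_ker_adj: "op_ran adj \<subseteq> op_ker adj"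
proof
  fix y assume "y \<in> op_ran adj"
  then obtain v where v: "v \<in> op_dom adj" "y = op_app adj v" by (auto simp: op_ran_def)
  have "s (op_app \<Gamma> u) y = 0" if "u \<in> op_dom \<Gamma>" for u
  proof -
    have "op_app \<Gamma> u \<in> op_dom \<Gamma>" "op_app \<Gamma> (op_app \<Gamma> u) = 0"
      using app_in_ker[OF that] by (auto simp: op_ker_def)
    then show ?thesis using adj[OF v(1), of "op_app \<Gamma> u"] v(2) by simp
  qed
  then show "y \<in> op_ker adj" unfolding ker_adj using eq_0_commute by (auto simp: orth_def op_ran_def)
qed

lemma closure_ran_adj_subset_ker_adj: "closure (op_ran adj) \<subseteq> op_ker adj"
  using ran_adj_subset_ker_adj unfolding ker_adj by (rule closure_minimal) (rule closed_orth)

lemma ker_orth_ran_adj: "op_ker \<Gamma> \<subseteq> orth (op_ran adj)"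
proof
  fix k assume k: "k \<in> op_ker \<Gamma>"
  then have "s k (op_app adj v) = 0" if "v \<in> op_dom adj" for v
    using adj[OF that, of k] by (simp add: op_ker_def)
  then show "k \<in> orth (op_ran adj)" by (auto simp: orth_def op_ran_def)
qed

text \<open>A vector in the kernel of the sum is orthogonal to the range of \<Gamma> by
  \<open>ker_sum_adj\<close> and, lying in the kernel of \<Gamma>, to the range of the
  adjoint.\<close>

lemma ran_sum_orth_ker_sum:
  "closure (op_ran (op_sum \<Gamma> adj)) \<subseteq> orth (op_ker (op_sum \<Gamma> adj))"
proof (rule closure_minimal[OF _ closed_orth], rule subsetI)
  fix y assume "y \<in> op_ran (op_sum \<Gamma> adj)"
  then obtain u where u: "u \<in> op_dom \<Gamma>" "u \<in> op_dom adj" "y = op_app \<Gamma> u + op_app adj u"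
    by (rule ran_sumE)
  have "s k y = 0" if "k \<in> op_ker (op_sum \<Gamma> adj)" for k
  proof -
    have "k \<in> orth (op_ran \<Gamma>)" "k \<in> orth (op_ran adj)"
      using that ker_orth_ran_adj by (auto simp: ker_sum_adj)
    then have "s k (op_app \<Gamma> u) = 0" "s k (op_app adj u) = 0"
      using u by (auto simp: orth_def op_ran_def)
    then show ?thesis by (simp add: u(3) add_right)
  qed
  then show "y \<in> orth (op_ker (op_sum \<Gamma> adj))" using eq_0_commute by (auto simp: orth_def)
qed

text \<open>The orthogonal complement of \<open>ran \<Gamma>\<^sup>*\<close> is read off the orthogonal projection of \<open>(v, 0)\<close> onto
  the graph of \<open>\<Gamma>\<close>.\<close>

lemma orth_ran_adj:
  assumes "hilbert_space scl s"
  shows "orth (op_ran adj) = op_ker \<Gamma>"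
proof
  show "orth (op_ran adj) \<subseteq> op_ker \<Gamma>"
  proof
    fix v assume v: "v \<in> orth (op_ran adj)"
    interpret P: coercive_form "\<lambda>a z. (scl a (fst z), scl a (snd z))"
      "\<lambda>z w. s (fst z) (fst w) + s (snd z) (snd w)"
      by (rule hilbert_space.coercive_form_ip[OF hilbert_space_prod[OF assms]])
    let ?G = "{(u, op_app \<Gamma> u) | u. u \<in> op_dom \<Gamma>}"
    have "P.subspace ?G"
      by (rule P.subspaceI)
        (auto simp: zero_prod_def app_0 app_add app_scale subspace_0[OF subspace_dom]
          subspace_add[OF subspace_dom] subspace_scale[OF subspace_dom])
    moreover have "Topological_Spaces.closed ?G" using closed by (simp add: closed_op_def)
    ultimately obtain z w where zw: "(v, 0) = z + w" "z \<in> ?G" "w \<in> P.orth ?G"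
      by (rule P.projection_theorem)
    obtain u where u: "u \<in> op_dom \<Gamma>" "z = (u, op_app \<Gamma> u)" using zw(2) by blast
    obtain a b where w: "w = (a, b)" by (cases w)
    have v_eq: "v = u + a" and b_eq: "op_app \<Gamma> u = - b"
      using zw(1) by (auto simp: u w add_eq_0_iff2 add_eq_0_iff)
    \<comment> \<open>Orthogonality of \<open>(a, b)\<close> to the graph says exactly that
      \<open>b\<close> is in the domain of the adjoint, with value \<open>- a\<close>.\<close>
    have "s (op_app \<Gamma> x) b = s x (- a)" if "x \<in> op_dom \<Gamma>" for x
    proof -
      have "s a x + s b (op_app \<Gamma> x) = 0"
        using zw(3) that by (fastforce simp: P.orth_def w)
      then have "s x a + s (op_app \<Gamma> x) b = 0"
        using P.eq_0_commute[of "(a, b)" "(x, op_app \<Gamma> x)"] by simp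
      then show ?thesis by (simp add: minus_right add_eq_0_iff)
    qed
    note b = adj_eq[OF this]
    \<comment> \<open>Since \<open>- a\<close> lies in the range of the adjoint, it is orthogonal to
      \<open>v\<close>. Expanding \<open>v = u + a\<close> and replacing \<open>s u a\<close> by
      \<open>s b b\<close> leaves a vanishing sum of two squared lengths.\<close>
    have "s v (- a) = 0" using v b by (auto simp: orth_def op_ran_def)
    then have "s v a = 0" by (simp add: minus_right)
    then have "s u a + s a a = 0" by (simp add: v_eq add_left)
    moreover have "s u a = s b b"
      using adj[OF b(1) u(1)] by (simp add: b(2) b_eq minus_left minus_right)
    ultimately have "(of_real (q b + q a) :: 'k) = of_real 0" by (simp add: self)
    then have "q b + q a = 0" unfolding of_real_eq_iff .
    then have "a = 0" "b = 0" using q_nonneg[of a] q_nonneg[of b] q_pos[of a] q_pos[of b] by force+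
    then show "v \<in> op_ker \<Gamma>" using u v_eq b_eq by (simp add: op_ker_def)
  qed
qed (rule ker_orth_ran_adj)

text \<open>Removing from \<open>u\<close> its component in the kernel of \<Gamma> does not change
  its image. The rest \<open>m\<close> lies in the closure of the range of the adjoint, hence in the
  kernel of the adjoint, so the sum acts on \<open>m\<close> as \<Gamma>.\<close>

lemma ran_subset_ran_sum:
  assumes "hilbert_space scl s"
  shows "op_ran \<Gamma> \<subseteq> op_ran (op_sum \<Gamma> adj)"
proof
  fix y assume "y \<in> op_ran \<Gamma>"
  then obtain u where u: "u \<in> op_dom \<Gamma>" "y = op_app \<Gamma> u" by (auto simp: op_ran_def)
  obtain m n where mn: "u = m + n" "m \<in> closure (op_ran adj)" "n \<in> orth (closure (op_ran adj))"
    using projection_theorem[OF subspace_closure[OF subspace_ran_adj] closed_closure] by blast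
  have n: "n \<in> op_ker \<Gamma>" using mn(3) by (simp add: orth_closure orth_ran_adj[OF assms])
  have m: "m \<in> op_ker adj" using mn(2) closure_ran_adj_subset_ker_adj by blast
  have "u - n \<in> op_dom \<Gamma>" using n u(1) by (intro subspace_diff subspace_dom) (auto simp: op_ker_def)
  then have "m \<in> op_dom \<Gamma>" using mn(1) by simp
  moreover from this have "op_app \<Gamma> m = y" using n u mn(1) by (simp add: app_add op_ker_def)
  ultimately show "y \<in> op_ran (op_sum \<Gamma> adj)" using m by (intro ran_sumI[of m]) (auto simp: op_ker_def)
qed

text \<open>The same argument with the roles of \<Gamma> and its adjoint exchanged.\<close>

lemma ran_adj_subset_ran_sum: "op_ran adj \<subseteq> op_ran (op_sum \<Gamma> adj)"
proof
  fix y assume "y \<in> op_ran adj"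
  then obtain u where u: "u \<in> op_dom adj" "y = op_app adj u" by (auto simp: op_ran_def)
  obtain m n where mn: "u = m + n" "m \<in> closure (op_ran \<Gamma>)" "n \<in> orth (closure (op_ran \<Gamma>))"
    using projection_theorem[OF subspace_closure[OF subspace_ran] closed_closure] by blast
  have n: "n \<in> op_ker adj" using mn(3) by (simp add: orth_closure ker_adj)
  have m: "m \<in> op_ker \<Gamma>" using mn(2) closure_ran_subset_ker by blast
  have "u - n \<in> op_dom adj"
    using n u(1) by (intro subspace_diff subspace_dom_adj) (auto simp: op_ker_def)
  then have "m \<in> op_dom adj" using mn(1) by simp
  moreover from this have "op_app adj m = y" using n u mn(1) by (simp add: adj_add op_ker_def)
  ultimately show "y \<in> op_ran (op_sum \<Gamma> adj)" using m by (intro ran_sumI[of m]) (auto simp: op_ker_def)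
qed

section \<open>Complements of the closed range of the sum\<close>

lemma ker_plus_ran_sum:
  assumes "hilbert_space scl s"
  obtains k r where "x = k + r" "k \<in> op_ker \<Gamma>" "r \<in> closure (op_ran (op_sum \<Gamma> adj))"
proof -
  obtain m n where mn: "x = m + n" "m \<in> closure (op_ran adj)" "n \<in> orth (closure (op_ran adj))"
    using projection_theorem[OF subspace_closure[OF subspace_ran_adj] closed_closure] by blast
  have "n \<in> op_ker \<Gamma>" using mn(3) by (simp add: orth_closure orth_ran_adj[OF assms])
  moreover have "m \<in> closure (op_ran (op_sum \<Gamma> adj))"
    using mn(2) closure_mono[OF ran_adj_subset_ran_sum] by blast
  ultimately show ?thesis using mn(1) by (intro that[of n m]) (auto simp: add.commute)
qed

text \<open>In the splitting \<open>x = p + g\<close> of \<open>hodge_ker\<close>, the part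
  \<open>p\<close> is orthogonal to \<open>x\<close>, which is in the closed range of the sum, and
  to \<open>g\<close>. So it is orthogonal to itself.\<close>

lemma ker_inter_ran_sum:
  assumes "x \<in> op_ker \<Gamma>" "x \<in> closure (op_ran (op_sum \<Gamma> adj))"
  shows "x \<in> closure (op_ran \<Gamma>)"
proof -
  obtain p g where pg: "x = p + g" "p \<in> op_ker (op_sum \<Gamma> adj)" "g \<in> closure (op_ran \<Gamma>)"
    using hodge_ker[OF assms(1)] by blast
  have "s p x = 0" using assms(2) pg(2) ran_sum_orth_ker_sum eq_0_commute by (auto simp: orth_def)
  moreover have "p \<in> orth (closure (op_ran \<Gamma>))" using pg(2) by (simp add: ker_sum_adj orth_closure)
  then have "s p g = 0" using pg(3) by (simp add: orth_def)
  ultimately have "p = 0" by (simp add: pg(1) add_right self_eq_0_iff)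
  then show ?thesis using pg by simp
qed

text \<open>The complement of the kernel is formed with respect to a Hilbert space inner product, which
  may differ from the form \<open>s\<close> defining the kernel.\<close>

lemma direct_sum_ker_sum:
  assumes "hilbert_space scl ip" and "nilpotent_operator scl ip \<Gamma>"
  defines "N \<equiv> closure (op_ran (op_sum \<Gamma> (op_adjoint ip \<Gamma>)))"
  shows "direct_sum scl (op_ker (op_sum \<Gamma> adj)) N" (is ?sum)
    and "\<exists>K. \<forall>x\<in>op_ker \<Gamma>. norm (proj_along (op_ker (op_sum \<Gamma> adj)) N x) \<le> K * norm x"
proof -
  interpret H: nilpotent_operator scl ip \<Gamma> by fact
  have N: "subspace N" unfolding N_def by (intro H.subspace_closure H.subspace_ran_sum)
  have ran_N: "closure (op_ran \<Gamma>) \<subseteq> N"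
    unfolding N_def by (rule closure_mono[OF H.ran_subset_ran_sum[OF assms(1)]])
  show sum: ?sum
    unfolding direct_sum_def
  proof (intro conjI allI)
    show "op_ker (op_sum \<Gamma> adj) \<inter> N = {0}"
    proof (intro equalityI subsetI)
      fix x assume x: "x \<in> op_ker (op_sum \<Gamma> adj) \<inter> N"
      \<comment> \<open>Membership in the closure of the range of \<Gamma> comes from the
        orthogonality for \<open>ip\<close>, the vanishing of \<open>x\<close> from that for
        \<open>s\<close>.\<close>
      then have "x \<in> closure (op_ran \<Gamma>)"
        using H.ker_inter_ran_sum[of x] by (simp add: N_def ker_sum_adj)
      with x show "x \<in> {0}" using ker_sum_closure_ran by simp
    qed (use subspace_0[OF subspace_ker_sum] subspace_0[OF N] in auto)
    fix x
    obtain k r where k: "x = k + r" "k \<in> op_ker \<Gamma>" "r \<in> N"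
      unfolding N_def using H.ker_plus_ran_sum[OF assms(1)] by blast
    obtain p g where p: "k = p + g" "p \<in> op_ker (op_sum \<Gamma> adj)" "g \<in> closure (op_ran \<Gamma>)"
      using hodge_ker[OF k(2)] by blast
    have "g + r \<in> N" using p(3) k(3) ran_N by (intro subspace_add N) auto
    then show "\<exists>m\<in>op_ker (op_sum \<Gamma> adj). \<exists>n\<in>N. x = m + n"
      using p k(1) by (metis add.assoc)
  qed (use N closed_ker_sum subspace_ker_sum N_def in auto)
  obtain K where K: "\<And>x y. q x \<le> q y \<Longrightarrow> norm x \<le> K * norm y"
    using norm_le_of_q_le by blast
  have "norm (proj_along (op_ker (op_sum \<Gamma> adj)) N x) \<le> K * norm x" if x: "x \<in> op_ker \<Gamma>" for x
  proof -
    obtain p g where p: "x = p + g" "p \<in> op_ker (op_sum \<Gamma> adj)" "g \<in> closure (op_ran \<Gamma>)" "q p \<le> q x"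
      using hodge_ker[OF x] by blast
    \<comment> \<open>On the kernel of \<Gamma> the remainder \<open>g\<close> already lies in
      \<open>N\<close>, so the projection along \<open>N\<close> is the \<open>s\<close>-orthogonal
      one and inherits its bound.\<close>
    have "proj_along (op_ker (op_sum \<Gamma> adj)) N x = p"
      using p(3) ran_N by (intro proj_along_eq[OF sum p(2)]) (auto simp: p(1))
    with K[OF p(4)] show ?thesis by simp
  qed
  then show "\<exists>K. \<forall>x\<in>op_ker \<Gamma>. norm (proj_along (op_ker (op_sum \<Gamma> adj)) N x) \<le> K * norm x"
    by blast
qed

end

theorem theoremA15:
  fixes scl :: "'k::hilbert_scalar \<Rightarrow> 'h::banach \<Rightarrow> 'h"
    and ip :: "'h \<Rightarrow> 'h \<Rightarrow> 'k"
    and \<Gamma> \<Pi>\<^sub>0 \<Pi>\<^sub>B :: "'h unbounded_op"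
    and B P\<^sub>1 P\<^sub>2 :: "'h \<Rightarrow> 'h"
  assumes "hilbert_space scl ip"
    and "separable_space (euclidean :: 'h topology)"
    and "linear_op scl \<Gamma>" and "closed_op \<Gamma>" and "densely_defined \<Gamma>" and "nilpotent_op \<Gamma>"
    and "bounded_linear B" and "isomorphism_on scl UNIV UNIV B"
    and "self_adjoint_map ip B" and "positive_definite ip B"
    and "\<Pi>\<^sub>0 = op_sum \<Gamma> (op_adjoint ip \<Gamma>)"
    and "\<Pi>\<^sub>B = op_sum \<Gamma> (op_adjoint (weighted_ip B ip) \<Gamma>)"
    and "P\<^sub>1 = proj_along (op_ker \<Pi>\<^sub>B) (closure (op_ran \<Pi>\<^sub>0))"
    and "P\<^sub>2 = proj_along (op_ker \<Pi>\<^sub>0) (closure (op_ran \<Pi>\<^sub>0))"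
  shows "direct_sum scl (op_ker \<Pi>\<^sub>B) (closure (op_ran \<Pi>\<^sub>0)) \<and>
    direct_sum scl (op_ker \<Pi>\<^sub>0) (closure (op_ran \<Pi>\<^sub>0)) \<and>
    isomorphic_subspaces scl (op_ker \<Pi>\<^sub>B) (op_ker \<Pi>\<^sub>0) \<and>
    isomorphism_on scl (op_ker \<Pi>\<^sub>0) (op_ker \<Pi>\<^sub>B) P\<^sub>1 \<and>
    isomorphism_on scl (op_ker \<Pi>\<^sub>B) (op_ker \<Pi>\<^sub>0) P\<^sub>2 \<and>
    (\<forall>v\<in>op_ker \<Pi>\<^sub>B. inv_into (op_ker \<Pi>\<^sub>0) P\<^sub>1 v = P\<^sub>2 v)"
proof -
  interpret I: coercive_form scl ip
    by (rule hilbert_space.coercive_form_ip[OF assms(1)])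
  interpret W: coercive_form scl "weighted_ip B ip"
    by (rule coercive_form_weighted_ip[OF assms(1,7-10)])
  interpret I: nilpotent_operator scl ip \<Gamma>
    by unfold_locales (fact assms(3-6))+
  interpret W: nilpotent_operator scl "weighted_ip B ip" \<Gamma>
    by unfold_locales (fact assms(3-6))+
  \<comment> \<open>Both instances use the same \<open>N\<close>, built from \<open>ip\<close>; only
    the form defining the kernel varies.\<close>
  note I = I.direct_sum_ker_sum[OF assms(1) I.nilpotent_operator_axioms, folded assms(11)]
  note W = W.direct_sum_ker_sum[OF assms(1) I.nilpotent_operator_axioms, folded assms(11,12)]
  obtain K where K: "\<And>x. x \<in> op_ker \<Gamma> \<Longrightarrow> norm (P\<^sub>2 x) \<le> K * norm x"
    using I(2) unfolding assms(14) by blast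
  obtain L where L: "\<And>x. x \<in> op_ker \<Gamma> \<Longrightarrow> norm (P\<^sub>1 x) \<le> L * norm x"
    using W(2) unfolding assms(13) by blast
  \<comment> \<open>The bounds \<open>K\<close> and \<open>L\<close> hold on the kernel of \<Gamma>;
    these inclusions make them available on the domains of both projections.\<close>
  have ker: "op_ker \<Pi>\<^sub>0 \<subseteq> op_ker \<Gamma>" "op_ker \<Pi>\<^sub>B \<subseteq> op_ker \<Gamma>"
    unfolding assms(11,12) I.ker_sum_adj W.ker_sum_adj by auto
  have "isomorphism_on scl (op_ker \<Pi>\<^sub>0) (op_ker \<Pi>\<^sub>B) P\<^sub>1"
    and "\<And>v. v \<in> op_ker \<Pi>\<^sub>B \<Longrightarrow> inv_into (op_ker \<Pi>\<^sub>0) P\<^sub>1 v = P\<^sub>2 v"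
    using I.isomorphism_proj_along[OF I(1) W(1), folded assms(13,14), OF L K] ker by blast+
  moreover have "isomorphism_on scl (op_ker \<Pi>\<^sub>B) (op_ker \<Pi>\<^sub>0) P\<^sub>2"
    using I.isomorphism_proj_along(1)[OF W(1) I(1), folded assms(13,14), OF K L] ker by blast
  ultimately show ?thesis
    using I(1) W(1) unfolding isomorphic_subspaces_def by blast
qed

end
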